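(* Let $D=(V,E)$ be a digraph and $e\in E$ an arc of $D$. Then \[ \pi(D)= \begin{cases} \pi(D_{-e}) & \text{if } e \text{ is a loop},\\ \pi(D_{-e})+x\,\pi(D_{/e})-x\,\pi(D_{\dagger e})+x & \text{if } e \text{ is not a loop}. \end{cases} \]
   Context: Digraphs are finite directed multigraphs; loops and multiple arcs are allowed. A directed path of length $k\ge 1$ consists of $k+1$ distinct vertices $v_0,\dots,v_k$ together with arcs $(v_0,v_1),\dots,(v_{k-1},v_k)$. Paths are counted as sets of arcs, so parallel arcs give different paths, and single vertices are not paths. The path polynomial is $\pi(D)=\pi(D;x)=\sum_{k=1}^{|V|-1}p_k(D)x^k$, where $p_k(D)$ is the number of directed paths of length $k$ in $D$. The arc operations are as follows. $D_{-e}$ is obtained by deleting the arc $e$. If $e=(u,v)$ with $u\ne v$, then $D_{/e}$ is obtained from $D$ by removing all arcs with tail $u$ and all arcs with head $v$ (this includes $e$), and then identifying $u$ and $v$ into one new vertex. If $e=(u,u)$ is a loop, then $D_{/e}$ is obtained by deleting $u$ and its incident arcs. For $e=(u,v)$, $D_{\dagger e}$ is obtained by deleting $u$ and $v$ and all arcs incident to them. *)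

theory Defs
  imports
    "HOL-Computational_Algebra.Polynomial"
    "Graph_Theory.Arc_Walk"
begin

text \<open>
  A finite directed multigraph (loops and parallel arcs allowed) is an arbitrary
  \<^locale>\<open>fin_digraph\<close>.
\<close>

text \<open>
  Paths of length \<open>k\<close>, as sets of arcs. Parallel arcs are distinct elements of \<open>arcs D\<close>,
  so they give different paths.
\<close>
definition dipaths :: "('a, 'b) pre_digraph \<Rightarrow> nat \<Rightarrow> 'b set set" where
  "dipaths D k = {set p |u p v. pre_digraph.apath D u p v \<and> length p = k}"

definition path_count :: "('a, 'b) pre_digraph \<Rightarrow> nat \<Rightarrow> nat" where
  "path_count D k = card (dipaths D k)"

definition path_poly :: "('a, 'b) pre_digraph \<Rightarrow> int poly" where
  "path_poly D = (\<Sum>k = 1..card (verts D) - 1. monom (int (path_count D k)) k)"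

text \<open>
  For a non-loop \<open>e\<close> from \<open>u\<close> to \<open>v\<close>, the vertex obtained by identifying \<open>u\<close> and \<open>v\<close> is
  again called \<open>u\<close>. An arc from \<open>v\<close> to \<open>u\<close> becomes a loop at it.
\<close>
definition contract_arc :: "('a, 'b) pre_digraph \<Rightarrow> 'b \<Rightarrow> ('a, 'b) pre_digraph" where
  "contract_arc D e =
    (let u = tail D e; v = head D e; merge = (\<lambda>w. if w = v then u else w)
     in if u = v then pre_digraph.del_vert D u
        else \<lparr> verts = merge ` verts D,
               arcs = {a \<in> arcs D. tail D a \<noteq> u \<and> head D a \<noteq> v},
               tail = merge \<circ> tail D,
               head = merge \<circ> head D \<rparr>)"

definition extract_arc :: "('a, 'b) pre_digraph \<Rightarrow> 'b \<Rightarrow> ('a, 'b) pre_digraph" where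
  "extract_arc D e = pre_digraph.del_vert (pre_digraph.del_vert D (tail D e)) (head D e)"

end

theory Submission
  imports Defs
begin

text \<open>
  For a non-loop \<open>e = (u, v)\<close>, the paths avoiding \<open>e\<close> are the paths of \<open>D\<^sub>-\<^sub>e\<close>. Removing \<open>e\<close>
  from a path through \<open>e\<close> leaves a path of \<open>D\<^sub>/\<^sub>e\<close> visiting the merged vertex, empty exactly when
  the path was \<open>{e}\<close>. Conversely, every arc of \<open>D\<^sub>/\<^sub>e\<close> entering the merged vertex has head \<open>u\<close>
  in \<open>D\<close> and every arc leaving it has tail \<open>v\<close>, so \<open>e\<close> can be reinserted there in exactly one
  way. The paths of \<open>D\<^sub>/\<^sub>e\<close> missing the merged vertex are those of \<open>D\<^sub>\<dagger>\<^sub>e\<close>.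
\<close>

section \<open>Paths after deleting a vertex or an arc\<close>

context pre_digraph
begin

lemma awalk_verts_del_vert [simp]:
  "pre_digraph.awalk_verts (del_vert z) w p = awalk_verts w p"
  by (simp add: pre_digraph.awalk_verts_conv tail_del_vert head_del_vert)

lemma awalk_verts_del_arc [simp]:
  "pre_digraph.awalk_verts (del_arc a) w p = awalk_verts w p"
  by (simp add: pre_digraph.awalk_verts_conv)

end

context wf_digraph
begin

lemma apath_del_vert_iff:
  "pre_digraph.apath (del_vert z) w p y \<longleftrightarrow> apath w p y \<and> z \<notin> set (awalk_verts w p)"
proof (induction p arbitrary: w)
  case Nil
  interpret H: wf_digraph "del_vert z" by (rule wf_digraph_del_vert)
  show ?case by (auto simp: apath_Nil_iff H.apath_Nil_iff pre_digraph.verts_del_vert)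
next
  case (Cons a p)
  interpret H: wf_digraph "del_vert z" by (rule wf_digraph_del_vert)
  show ?case
    by (auto dest: hd_in_awalk_verts simp: apath_Cons_iff H.apath_Cons_iff pre_digraph.del_vert_simps Cons.IH)
qed

lemma apath_del_arc_iff:
  "pre_digraph.apath (del_arc a) w p y \<longleftrightarrow> apath w p y \<and> a \<notin> set p"
proof (induction p arbitrary: w)
  case Nil
  interpret H: wf_digraph "del_arc a" by (rule wf_digraph_del_arc)
  show ?case by (auto simp: apath_Nil_iff H.apath_Nil_iff)
next
  case (Cons b p)
  interpret H: wf_digraph "del_arc a" by (rule wf_digraph_del_arc)
  show ?case
    by (auto simp: apath_Cons_iff H.apath_Cons_iff Cons.IH)
qed

lemma dipaths_del_arc: "dipaths (del_arc a) k = {S \<in> dipaths G k. a \<notin> S}"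
  unfolding dipaths_def apath_del_arc_iff by auto

lemma last_in_awalk_verts:
  assumes "apath w p y" shows "y \<in> set (awalk_verts w p)"
  using assms by (metis apath_def awalk_verts_non_Nil awlast_of_awalk last_in_set awalkE')

text \<open>Names the junction vertex explicitly, so that a path can be split at a prescribed
  \<open>w\<close>. The junction occurs in both vertex lists, hence the \<open>tl\<close> in the
  disjointness condition.\<close>

lemma apath_append_at_iff:
  "apath x (p @ q) y \<and> awlast x p = w \<longleftrightarrow>
    apath x p w \<and> apath w q y \<and> set (awalk_verts x p) \<inter> set (tl (awalk_verts w q)) = {}"
proof (cases "awlast x p = w")
  case True
  then show ?thesis by (simp only: apath_append_iff simp_thms)
next
  case False
  then have "\<not> apath x p w" using awlast_of_awalk[of x p w] by (metis awalkE awalkI_apath)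
  with False show ?thesis by simp
qed

end

section \<open>Path counts as coefficients\<close>

context fin_digraph
begin

lemma finite_dipaths: "finite (dipaths G k)"
  by (rule finite_subset[of _ "Pow (arcs G)"]) (auto simp: dipaths_def apath_def awalk_def)

text \<open>A path of length \<open>k\<close> has k + 1 distinct vertices, so no path reaches the
  length \<open>card (verts G)\<close> and the upper bound of the sum can be forgotten. This makes
  digraphs with different numbers of vertices comparable. Degree 0 is set apart because
  \<open>dipaths G 0\<close> contains the empty set as soon as there is a vertex.\<close>

lemma coeff_path_poly:
  "coeff (path_poly G) k = (if k = 0 then 0 else int (path_count G k))"
proof -
  have "dipaths G k = {}" if "card (verts G) \<le> k"
    using that length_apath_less unfolding dipaths_def by (fastforce simp: not_less)
  then have "path_count G k = 0" if "card (verts G) \<le> k"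
    using that by (simp add: path_count_def)
  then show ?thesis
    unfolding path_poly_def by (auto simp: coeff_sum coeff_monom not_le)
qed

end

section \<open>Contraction and extraction at a non-loop arc\<close>

locale nonloop_arc = fin_digraph +
  fixes e u v
  assumes e_arc: "e \<in> arcs G" and tail_e: "tail G e = u" and head_e: "head G e = v"
    and nonloop: "u \<noteq> v"
begin

abbreviation "H \<equiv> contract_arc G e"
abbreviation "K \<equiv> extract_arc G e"

lemma u_in_verts: "u \<in> verts G" and v_in_verts: "v \<in> verts G"
  using e_arc tail_e head_e by (auto intro: wellformed)

lemma contract_simps:
  "verts H = verts G - {v}"
  "arcs H = {a \<in> arcs G. tail G a \<noteq> u \<and> head G a \<noteq> v}"
  "tail H a = (if tail G a = v then u else tail G a)"
  "head H a = (if head G a = v then u else head G a)"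
  using nonloop u_in_verts
  by (auto simp: contract_arc_def Let_def tail_e head_e)

sublocale H: fin_digraph H
  by unfold_locales (auto simp: contract_simps nonloop u_in_verts)

lemma fin_digraph_extract: "fin_digraph K"
  unfolding extract_arc_def
  by (intro fin_digraph.fin_digraph_del_vert fin_digraph_del_vert)

sublocale K: fin_digraph K
  by (rule fin_digraph_extract)

lemma extract_simps:
  "verts K = verts G - {u, v}"
  "arcs K = {a \<in> arcs G. tail G a \<notin> {u, v} \<and> head G a \<notin> {u, v}}"
  "tail K = tail G" "head K = head G"
  by (auto simp: extract_arc_def pre_digraph.del_vert_simps tail_e head_e)

lemma awalk_verts_extract [simp]: "K.awalk_verts w p = awalk_verts w p"
  by (simp add: pre_digraph.awalk_verts_conv extract_simps)

section \<open>Transfer of paths between \<open>G\<close>, \<open>H\<close> and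
  \<open>K\<close>\<close>

lemma apath_extract_iff:
  "K.apath w p y \<longleftrightarrow> apath w p y \<and> u \<notin> set (awalk_verts w p) \<and> v \<notin> set (awalk_verts w p)"
  by (auto simp: extract_arc_def tail_e head_e wf_digraph.apath_del_vert_iff
      wf_digraph_del_vert apath_del_vert_iff)

lemma awalk_verts_contract_avoiding:
  "K.apath w p y \<Longrightarrow> H.awalk_verts w p = awalk_verts w p"
  by (induction p arbitrary: w)
    (auto simp: K.apath_Cons_iff contract_simps extract_simps)

text \<open>An arc with a renamed end would visit \<open>u\<close> in \<open>H\<close>. On a path of
  \<open>H\<close> missing \<open>u\<close> no renaming takes place, so its arcs survive in
  \<open>K\<close>.\<close>

lemma apath_extract_iff_contract:
  "K.apath w p y \<longleftrightarrow> H.apath w p y \<and> u \<notin> set (H.awalk_verts w p)"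
proof (induction p arbitrary: w)
  case Nil
  show ?case by (auto simp: K.apath_Nil_iff H.apath_Nil_iff extract_simps contract_simps)
next
  case (Cons a p)
  have avoid: "head H a \<noteq> u" if "u \<notin> set (H.awalk_verts (head H a) p)" "H.apath (head H a) p y"
    using that H.hd_in_awalk_verts(2) by metis
  show ?case
  proof
    assume K: "K.apath w (a # p) y"
    then have a: "tail H a = tail G a" "head H a = head G a" "a \<in> arcs H" "tail G a \<noteq> u"
      and p: "K.apath (head G a) p y" "tail G a = w" "tail G a \<notin> set (awalk_verts (head G a) p)"
      by (auto simp: K.apath_Cons_iff contract_simps extract_simps)
    from awalk_verts_contract_avoiding[OF p(1)] Cons.IH p a
    show "H.apath w (a # p) y \<and> u \<notin> set (H.awalk_verts w (a # p))"
      by (simp add: H.apath_Cons_iff)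
  next
    assume H: "H.apath w (a # p) y \<and> u \<notin> set (H.awalk_verts w (a # p))"
    then have *: "a \<in> arcs H" "tail H a = w" "H.apath (head H a) p y" "tail H a \<noteq> u"
      "u \<notin> set (H.awalk_verts (head H a) p)" "tail H a \<notin> set (H.awalk_verts (head H a) p)"
      by (auto simp: H.apath_Cons_iff)
    then have K: "K.apath (head H a) p y" using Cons.IH by blast
    have "head H a \<noteq> u" using avoid * by blast
    then have "head H a = head G a" "tail H a = tail G a" "a \<in> arcs K"
      using * by (auto simp: contract_simps extract_simps split: if_splits)
    then show "K.apath w (a # p) y"
      using * K awalk_verts_contract_avoiding[OF K] by (simp add: K.apath_Cons_iff extract_simps)
  qed
qed

text \<open>This handles the part of a path before \<open>e\<close>. A path ending at
  \<open>u\<close> cannot leave \<open>u\<close> earlier, and no arc of \<open>H\<close> has head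
  \<open>v\<close> in \<open>G\<close>, so nothing on it is renamed. Both claims share one induction
  because the step of the first rewrites vertex lists by the second.\<close>

lemma apath_contract_prefix:
  "H.apath x p u \<longleftrightarrow> apath x p u \<and> v \<notin> set (awalk_verts x p)"
  "H.apath x p u \<Longrightarrow> H.awalk_verts x p = awalk_verts x p"
proof (induction p arbitrary: x)
  case Nil
  {
    case 1
    show ?case using nonloop by (auto simp: H.apath_Nil_iff apath_Nil_iff contract_simps u_in_verts)
  next
    case 2
    show ?case by simp
  }
next
  case (Cons a p)
  {
    case 1
    show ?case
    proof
      assume H: "H.apath x (a # p) u"
      then have *: "a \<in> arcs H" "tail H a = x" "H.apath (head H a) p u"
        "tail H a \<notin> set (H.awalk_verts (head H a) p)"
        by (auto simp: H.apath_Cons_iff)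
      \<comment> \<open>The remaining path ends at \<open>u\<close>, so distinctness excludes
        \<open>u\<close> as the tail. Since a tail \<open>v\<close> would be renamed to
        \<open>u\<close>, this also excludes \<open>v\<close> as the tail in
        \<open>G\<close>.\<close>
      then have "tail H a \<noteq> u" using H.last_in_awalk_verts by blast
      with * have "head H a = head G a" "tail H a = tail G a" "a \<in> arcs G" "tail G a \<noteq> v"
        by (auto simp: contract_simps split: if_splits)
      with * Cons.IH show "apath x (a # p) u \<and> v \<notin> set (awalk_verts x (a # p))"
        by (simp add: apath_Cons_iff)
    next
      assume G: "apath x (a # p) u \<and> v \<notin> set (awalk_verts x (a # p))"
      then have *: "a \<in> arcs G" "tail G a = x" "apath (head G a) p u" "tail G a \<noteq> v"
        "tail G a \<notin> set (awalk_verts (head G a) p)" "v \<notin> set (awalk_verts (head G a) p)"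
        by (auto simp: apath_Cons_iff)
      then have "tail G a \<noteq> u" "head G a \<noteq> v"
        using last_in_awalk_verts hd_in_awalk_verts(2) by blast+
      with * have "head H a = head G a" "tail H a = tail G a" "a \<in> arcs H"
        by (auto simp: contract_simps)
      with * Cons.IH show "H.apath x (a # p) u"
        by (simp add: H.apath_Cons_iff)
    qed
  next
    case 2
    then have *: "a \<in> arcs H" "tail H a = x" "H.apath (head H a) p u"
        "tail H a \<notin> set (H.awalk_verts (head H a) p)"
      by (auto simp: H.apath_Cons_iff)
    then have "tail H a \<noteq> u" using H.last_in_awalk_verts by blast
    with * have "head H a = head G a" "tail H a = tail G a"
      by (auto simp: contract_simps split: if_splits)
    with * Cons.IH show ?case by simp
  }
qed

text \<open>This handles the part after \<open>e\<close>. Its first arc leaves the merged vertex and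
  so has tail \<open>v\<close> in \<open>G\<close>; the rest is a path of \<open>K\<close>, common
  to both digraphs. The end is quantified because for empty \<open>q\<close> it is \<open>u\<close>
  in \<open>H\<close> but \<open>v\<close> in \<open>G\<close>.\<close>

lemma apath_contract_suffix:
  "(\<exists>y. H.apath u q y) \<longleftrightarrow> (\<exists>y. apath v q y) \<and> u \<notin> set (awalk_verts v q)"
proof (cases q)
  case Nil
  then show ?thesis
    using nonloop by (auto simp: H.apath_Nil_iff apath_Nil_iff contract_simps u_in_verts v_in_verts)
next
  case (Cons a q')
  show ?thesis
  proof
    assume "\<exists>y. H.apath u q y"
    then obtain y where *: "a \<in> arcs H" "tail H a = u" "H.apath (head H a) q' y"
      "u \<notin> set (H.awalk_verts (head H a) q')"
      unfolding Cons by (auto simp: H.apath_Cons_iff)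
    then have "a \<in> arcs G" "tail G a = v" "head H a = head G a"
      using H.hd_in_awalk_verts(2)[OF *(3)] by (auto simp: contract_simps split: if_splits)
    with * show "(\<exists>y. apath v q y) \<and> u \<notin> set (awalk_verts v q)"
      using apath_extract_iff apath_extract_iff_contract nonloop
      unfolding Cons by (auto simp: apath_Cons_iff)
  next
    assume "(\<exists>y. apath v q y) \<and> u \<notin> set (awalk_verts v q)"
    then obtain y where *: "a \<in> arcs G" "tail G a = v" "apath (head G a) q' y"
      "v \<notin> set (awalk_verts (head G a) q')" "u \<notin> set (awalk_verts (head G a) q')"
      unfolding Cons by (auto simp: apath_Cons_iff)
    then have "a \<in> arcs H" "tail H a = u" "head H a = head G a"
      using hd_in_awalk_verts(2)[OF *(3)] nonloop by (auto simp: contract_simps)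
    with * show "\<exists>y. H.apath u q y"
      using apath_extract_iff apath_extract_iff_contract
      unfolding Cons by (auto simp: H.apath_Cons_iff)
  qed
qed

text \<open>Only the starting vertex differs between the two digraphs; the remainder misses the
  merged vertex.\<close>

lemma awalk_verts_contract_suffix:
  assumes "H.apath u q y"
  shows "set (awalk_verts v q) = insert v (set (tl (H.awalk_verts u q)))"
proof (cases q)
  case (Cons a q')
  then have *: "a \<in> arcs H" "tail H a = u" "H.apath (head H a) q' y"
      "u \<notin> set (H.awalk_verts (head H a) q')"
    using assms by (auto simp: H.apath_Cons_iff)
  then have "tail G a = v" "head H a = head G a"
    using H.hd_in_awalk_verts(2)[OF *(3)] by (auto simp: contract_simps split: if_splits)
  moreover have "H.awalk_verts (head H a) q' = awalk_verts (head H a) q'"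
    using * by (intro awalk_verts_contract_avoiding) (simp add: apath_extract_iff_contract)
  ultimately show ?thesis using Cons by simp
qed simp

section \<open>Inserting the arc at the merged vertex\<close>

lemma apath_through_arc_iff_apaths:
  "apath x (p @ e # q) y \<longleftrightarrow> apath x p u \<and> apath v q y \<and> u \<notin> set (awalk_verts v q) \<and>
    set (awalk_verts x p) \<inter> set (awalk_verts v q) = {}"
proof -
  \<comment> \<open>The junction is forced, since \<open>e\<close> starts at \<open>u\<close>. The
    vertex list of \<open>e # q\<close> from \<open>u\<close> then has that of \<open>q\<close> from
    \<open>v\<close> as its tail, so the disjointness condition involves the latter in full.\<close>
  have "awlast x p = u" if "apath x (p @ e # q) y"
    using that by (simp only: apath_append_iff apath_Cons_iff tail_e)
  then have "apath x (p @ e # q) y \<longleftrightarrow> apath x (p @ e # q) y \<and> awlast x p = u"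
    by blast
  then show ?thesis
    by (simp only: apath_append_at_iff apath_Cons_iff tail_e head_e e_arc
        awalk_verts.simps list.sel simp_thms conj_assoc)
qed

text \<open>Prefixes and suffixes are transferred separately. The two disjointness conditions differ
  only by the vertex \<open>v\<close>, which starts the suffix in \<open>G\<close> and is absent
  from the prefix. The condition on \<open>awlast\<close> records that the split occurs at the
  merged vertex.\<close>

lemma apath_through_arc_iff:
  "(\<exists>x y. apath x (p @ e # q) y) \<longleftrightarrow> (\<exists>x y. H.apath x (p @ q) y \<and> H.awlast x p = u)"
proof -
  have "(\<exists>y. apath x (p @ e # q) y) \<longleftrightarrow> (\<exists>y. H.apath x (p @ q) y \<and> H.awlast x p = u)" for x
    unfolding apath_through_arc_iff_apaths H.apath_append_at_iff
  proof (intro iffI; elim exE conjE)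
    fix y
    assume *: "apath x p u" "apath v q y" "u \<notin> set (awalk_verts v q)"
      and disj: "set (awalk_verts x p) \<inter> set (awalk_verts v q) = {}"
    have "v \<in> set (awalk_verts v q)" using *(2) by (rule hd_in_awalk_verts(2))
    with disj have "v \<notin> set (awalk_verts x p)" by auto
    with * have p: "H.apath x p u" by (simp only: apath_contract_prefix(1) simp_thms)
    from * have "\<exists>y. H.apath u q y" unfolding apath_contract_suffix by blast
    then obtain y' where q: "H.apath u q y'" ..
    have "set (H.awalk_verts x p) \<inter> set (tl (H.awalk_verts u q)) = {}"
      using disj unfolding awalk_verts_contract_suffix[OF q] apath_contract_prefix(2)[OF p] by auto
    with p q show "\<exists>y. H.apath x p u \<and> H.apath u q y \<and>
        set (H.awalk_verts x p) \<inter> set (tl (H.awalk_verts u q)) = {}"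
      by (intro exI conjI)
  next
    fix y
    assume p: "H.apath x p u" and q: "H.apath u q y"
      and disj: "set (H.awalk_verts x p) \<inter> set (tl (H.awalk_verts u q)) = {}"
    from p have p': "apath x p u" "v \<notin> set (awalk_verts x p)"
      using apath_contract_prefix(1)[of x p] by simp_all
    from q have "\<exists>y. H.apath u q y" ..
    then obtain y' where q': "apath v q y'" "u \<notin> set (awalk_verts v q)"
      unfolding apath_contract_suffix by blast
    have "set (awalk_verts x p) \<inter> set (awalk_verts v q) = {}"
      using disj p'(2) unfolding awalk_verts_contract_suffix[OF q] apath_contract_prefix(2)[OF p]
      by auto
    with p' q' show "\<exists>y. apath x p u \<and> apath v q y \<and> u \<notin> set (awalk_verts v q) \<and>
        set (awalk_verts x p) \<inter> set (awalk_verts v q) = {}"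
      by (intro exI conjI)
  qed
  then show ?thesis by (simp only:)
qed

section \<open>Arc sets of paths through the merged vertex\<close>

lemma dipaths_extract_subset: "dipaths K k \<subseteq> dipaths H k"
  by (auto simp: dipaths_def apath_extract_iff_contract)

text \<open>An arc set does not carry its path, so it must be excluded that some other path of
  \<open>K\<close> has the same arcs. A nonempty path visiting \<open>u\<close> has an arc incident
  to \<open>u\<close> in \<open>H\<close>, and such an arc is missing from \<open>K\<close>. For
  \<open>k = 0\<close> the empty set would not reveal whether \<open>u\<close> is visited.\<close>

lemma dipaths_contract_diff_extract:
  assumes "k > 0"
  shows "dipaths H k - dipaths K k =
    {set p |w p y. H.apath w p y \<and> length p = k \<and> u \<in> set (H.awalk_verts w p)}" (is "_ = ?R")
proof
  show "dipaths H k - dipaths K k \<subseteq> ?R"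
  proof
    fix S assume S: "S \<in> dipaths H k - dipaths K k"
    then obtain w p y where p: "H.apath w p y" "length p = k" "S = set p"
      by (auto simp: dipaths_def)
    then have "\<not> K.apath w p y" using S by (auto simp: dipaths_def)
    with p show "S \<in> ?R" using apath_extract_iff_contract by auto
  qed
next
  have "set p \<notin> dipaths K k"
    if "length p = k" and visit: "u \<in> set (H.awalk_verts w p)" for w p
  proof -
    have "p \<noteq> []" using that assms by auto
    with visit obtain a where "a \<in> set p" "tail H a = u \<or> head H a = u"
      by (auto simp: H.awalk_verts_conv dest: last_in_set)
    then have "\<not> set p \<subseteq> arcs K"
      by (auto simp: contract_simps extract_simps split: if_splits)
    then show ?thesis by (auto simp: dipaths_def K.apath_def K.awalk_def)
  qed
  then show "?R \<subseteq> dipaths H k - dipaths K k"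
    by (auto simp: dipaths_def[of H])
qed

lemma dipaths_through_arc:
  assumes "k > 0"
  shows "(\<lambda>S. S - {e}) ` {S \<in> dipaths G (Suc k). e \<in> S} = dipaths H k - dipaths K k"
    (is "?L = _")
  unfolding dipaths_contract_diff_extract[OF assms]
proof (intro equalityI subsetI)
  fix T assume "T \<in> ?L"
  then obtain x r y where r: "apath x r y" "length r = Suc k" "e \<in> set r" "T = set r - {e}"
    by (auto simp: dipaths_def)
  then obtain p q where pq: "r = p @ e # q" by (meson split_list)
  \<comment> \<open>The path uses \<open>e\<close> only once, so removing \<open>e\<close> from the
    arc set leaves exactly the arcs of \<open>p\<close> and \<open>q\<close>.\<close>
  have "distinct r"
    using r(1) unfolding apath_def by (blast intro: distinct_verts_imp_distinct)
  then have "T = set (p @ q)" unfolding r(4) pq by auto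
  moreover obtain x' y' where H: "H.apath x' (p @ q) y'" "H.awlast x' p = u"
    using apath_through_arc_iff[of p q] r(1) unfolding pq by blast
  moreover have "u \<in> set (H.awalk_verts x' (p @ q))"
  proof -
    have "u \<in> set (H.awalk_verts x' p)"
      using last_in_set[OF H.awalk_verts_non_Nil[of x' p]] unfolding H(2) .
    then show ?thesis by (simp add: H.awalk_verts_append[OF H.awalkI_apath[OF H(1)]])
  qed
  moreover have "length (p @ q) = k" using r pq by simp
  ultimately show "T \<in> {set p |w p y. H.apath w p y \<and> length p = k \<and> u \<in> set (H.awalk_verts w p)}"
    by blast
next
  fix T assume "T \<in> {set p |w p y. H.apath w p y \<and> length p = k \<and> u \<in> set (H.awalk_verts w p)}"
  then obtain w r y where r: "H.apath w r y" "length r = k" "u \<in> set (H.awalk_verts w r)" "T = set r"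
    by blast
  \<comment> \<open>The path is cut where it visits the merged vertex; \<open>e\<close> is inserted
    at the cut.\<close>
  have "\<exists>p q. r = p @ q \<and> H.awalk w p u \<and> H.awalk u q y"
    using H.awalkI_apath[OF r(1)] r(3) by (rule H.awalk_decomp)
  then obtain p q where pq: "r = p @ q" "H.awalk w p u" by blast
  from pq(2) have "H.cas w p u" by (simp only: H.awalk_def)
  then have last: "H.awlast w p = u" by (rule H.awlast_if_cas)
  then obtain x' y' where G: "apath x' (p @ e # q) y'"
    using apath_through_arc_iff[of p q] r(1) last unfolding pq(1) by blast
  \<comment> \<open>Contraction drops all arcs with tail \<open>u\<close>, including
    \<open>e\<close>, so removing \<open>e\<close> undoes the insertion.\<close>
  have "e \<notin> set r"
    using r(1) tail_e by (auto simp: H.apath_def H.awalk_def contract_simps)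
  then have "T = set (p @ e # q) - {e}" using r pq by auto
  moreover have "length (p @ e # q) = Suc k" using r pq by simp
  ultimately show "T \<in> ?L"
    using G by (intro image_eqI[of _ _ "set (p @ e # q)"]) (auto simp only: dipaths_def mem_Collect_eq in_set_conv_decomp)
qed

section \<open>Counting and comparison of coefficients\<close>

lemma path_count_del_arc:
  "path_count G k = path_count (del_arc e) k + card {S \<in> dipaths G k. e \<in> S}"
proof -
  have split: "dipaths G k = dipaths (del_arc e) k \<union> {S \<in> dipaths G k. e \<in> S}"
    and "dipaths (del_arc e) k \<inter> {S \<in> dipaths G k. e \<in> S} = {}"
    by (auto simp: dipaths_del_arc)
  then have "card (dipaths (del_arc e) k \<union> {S \<in> dipaths G k. e \<in> S})
      = path_count (del_arc e) k + card {S \<in> dipaths G k. e \<in> S}"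
    unfolding path_count_def dipaths_del_arc
    by (intro card_Un_disjoint) (simp_all add: finite_dipaths)
  then show ?thesis
    unfolding split[symmetric] by (simp only: path_count_def)
qed

text \<open>Removing \<open>e\<close> is injective on sets containing \<open>e\<close>, so the paths
  through \<open>e\<close> are equinumerous with the difference set of \<open>H\<close> and
  \<open>K\<close>. The additive form avoids subtraction of natural numbers.\<close>

lemma path_count_Suc:
  assumes "k > 0"
  shows "path_count G (Suc k) + path_count K k = path_count (del_arc e) (Suc k) + path_count H k"
proof -
  have "card {S \<in> dipaths G (Suc k). e \<in> S} = card (dipaths H k - dipaths K k)"
    unfolding dipaths_through_arc[OF assms, symmetric]
    by (rule card_image[symmetric]) (auto simp: inj_on_def)
  also have "\<dots> + path_count K k = path_count H k"
    using dipaths_extract_subset H.finite_dipaths K.finite_dipaths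
    by (simp add: path_count_def card_Diff_subset card_mono)
  finally show ?thesis by (simp add: path_count_del_arc)
qed

text \<open>The single path \<open>{e}\<close> is the source of the extra summand x: removing its
  arc leaves the empty set, which is not counted as a path.\<close>

lemma path_count_one: "path_count G 1 = path_count (del_arc e) 1 + 1"
proof -
  have "apath u [e] v"
    using e_arc nonloop v_in_verts by (simp add: apath_simps tail_e head_e)
  then have "{S \<in> dipaths G 1. e \<in> S} = {{e}}"
    by (force simp: dipaths_def length_Suc_conv)
  then show ?thesis using path_count_del_arc[of 1] by simp
qed

lemma path_poly_nonloop:
  "path_poly G = path_poly (del_arc e) + monom 1 1 * path_poly H
     - monom 1 1 * path_poly K + monom 1 1"
proof (rule poly_eqI)
  fix k
  interpret d: fin_digraph "del_arc e" by (rule fin_digraph_del_arc)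
  note simps = coeff_path_poly d.coeff_path_poly H.coeff_path_poly K.coeff_path_poly
    coeff_monom_mult
  \<comment> \<open>Multiplication by x shifts degrees by one. In degree 1 the terms of
    \<open>H\<close> and \<open>K\<close> vanish, as path polynomials have no constant term; from
    degree 2 on \<open>path_count_Suc\<close> applies.\<close>
  consider "k = 0" | "k = 1" | j where "k = Suc j" "j > 0"
    by (cases k; cases "k - 1") auto
  then show "coeff (path_poly G) k = coeff (path_poly (del_arc e) + monom 1 1 * path_poly H
     - monom 1 1 * path_poly K + monom 1 1) k"
  proof cases
    case 2
    then show ?thesis using path_count_one by (simp add: simps)
  next
    case (3 j)
    then have "int (path_count G k) + int (path_count K j)
        = int (path_count (del_arc e) k) + int (path_count H j)"
      using path_count_Suc[of j] by (simp flip: of_nat_add)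
    with 3 show ?thesis by (simp add: simps)
  qed (simp add: simps)
qed

end

theorem theorem2p2:
  fixes D :: "('a, 'b) pre_digraph" and e :: 'b
  assumes "fin_digraph D"
    and "e \<in> arcs D"
  shows "path_poly D =
    (if tail D e = head D e
     then path_poly (pre_digraph.del_arc D e)
     else path_poly (pre_digraph.del_arc D e)
          + monom 1 1 * path_poly (contract_arc D e)
          - monom 1 1 * path_poly (extract_arc D e)
          + monom 1 1)"
proof (cases "tail D e = head D e")
  case True
  interpret fin_digraph D by fact
  \<comment> \<open>A loop would repeat its vertex, so no path uses it. Deleting it also keeps the
    vertex set, hence the range of summation.\<close>
  have "e \<notin> S" if "S \<in> dipaths D k" for S k
    using that True by (auto simp: dipaths_def dest: no_loops_in_apath)
  then have "dipaths (del_arc e) k = dipaths D k" for k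
    by (auto simp: dipaths_del_arc)
  then show ?thesis
    using True by (simp add: path_poly_def path_count_def)
next
  case False
  interpret fin_digraph D by fact
  interpret nonloop_arc D e "tail D e" "head D e"
    by unfold_locales (use assms(2) False in simp_all)
  show ?thesis
    unfolding if_not_P[OF False] by (rule path_poly_nonloop)
qed

end
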